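(* Let $E$ and $F$ be reflexive real Banach spaces. Then $(E,F)$ has the compact perturbation property if and only if $(F^*,E^* )$ has the compact perturbation property.
   Context: $\mathcal L(E,F)$ and $\mathcal K(E,F)$ denote the bounded and the compact linear operators from $E$ to $F$. An operator $T\in\mathcal L(E,F)$ attains its norm if $\|Tx\|=\|T\|$ for some $x$ in the unit sphere of $E$. A pair $(E,F)$ has the compact perturbation property (CPP) if for every $T\in\mathcal L(E,F)$ and $K\in\mathcal K(E,F)$, the inequality $\|T+K\|>\|T\|$ implies that $T+K$ attains its norm. *)

theory Defs
  imports "HOL-Analysis.Analysis"
begin

type_synonym 'a dual = "'a \<Rightarrow>\<^sub>L real"

definition canonical_embedding :: "'a::real_normed_vector \<Rightarrow> 'a dual dual" where
  "canonical_embedding x = Blinfun (\<lambda>f. blinfun_apply f x)"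

lemma canonical_embedding_apply [simp]:
  "blinfun_apply (canonical_embedding x) f = blinfun_apply f x"
  unfolding canonical_embedding_def
  by (simp add: bounded_linear_Blinfun_apply)

definition reflexive_space :: "'a::banach itself \<Rightarrow> bool" where
  "reflexive_space _ \<longleftrightarrow> surj (canonical_embedding :: 'a \<Rightarrow> 'a dual dual)"

definition compact_operator :: "('a::real_normed_vector \<Rightarrow>\<^sub>L 'b::real_normed_vector) \<Rightarrow> bool" where
  "compact_operator K \<longleftrightarrow> compact (closure (blinfun_apply K ` cball 0 1))"

definition attains_norm :: "('a::real_normed_vector \<Rightarrow>\<^sub>L 'b::real_normed_vector) \<Rightarrow> bool" where
  "attains_norm T \<longleftrightarrow> (\<exists>x\<in>sphere 0 1. norm (blinfun_apply T x) = norm T)"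

definition compact_perturbation_property ::
    "'a::banach itself \<Rightarrow> 'b::banach itself \<Rightarrow> bool" where
  "compact_perturbation_property _ _ \<longleftrightarrow>
     (\<forall>(T :: 'a \<Rightarrow>\<^sub>L 'b) K. compact_operator K \<longrightarrow> norm (T + K) > norm T \<longrightarrow> attains_norm (T + K))"

end

theory Submission
  imports Defs
begin

text \<open>
  The property transfers along the adjoint map \<open>T \<mapsto> T\<^sup>*\<close>, \<open>T\<^sup>* f = f \<circ> T\<close>, because every notion in
  the definition of the compact perturbation property is invariant under it. The adjoint map is
  linear and isometric. If \<open>F\<close> is reflexive, every operator from \<open>F\<^sup>*\<close> to \<open>E\<^sup>*\<close> is an adjoint
  (\<open>adjoint_surj\<close>), so the pairs \<open>(T, K)\<close> for \<open>(E, F)\<close> and for \<open>(F\<^sup>*, E\<^sup>*)\<close> correspond to each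
  other. By Schauder's theorem (\<open>compact_operator_adjoint_iff\<close>) \<open>K\<close> is compact exactly if \<open>K\<^sup>*\<close>
  is. Finally a nonzero operator attains its norm exactly if its adjoint does
  (\<open>attains_norm_adjoint_iff\<close>): if \<open>\<parallel>S x\<parallel> = \<parallel>S\<parallel>\<close>, then a norming functional of \<open>S x\<close> is a point
  where \<open>S\<^sup>*\<close> attains its norm; if \<open>\<parallel>S\<^sup>* f\<parallel> = \<parallel>S\<parallel>\<close>, then a norming element of \<open>E\<^sup>*\<^sup>*\<close> for
  \<open>S\<^sup>* f\<close> is evaluation at some point of \<open>E\<close>, by reflexivity, and \<open>S\<close> attains its norm there.
  An operator \<open>T + K\<close> with \<open>\<parallel>T + K\<parallel> > \<parallel>T\<parallel>\<close> is nonzero, so the last equivalence applies to it.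

  All of this rests on the existence of norming functionals, that is, on the Hahn--Banach theorem.
  It is derived here from the fact that a minimal sublinear functional is linear, which avoids
  extending functionals from subspaces.
\<close>

section \<open>Norming functionals\<close>

definition sublinear :: "('a::real_vector \<Rightarrow> real) \<Rightarrow> bool" where
  "sublinear p \<longleftrightarrow> (\<forall>x y. p (x + y) \<le> p x + p y) \<and> (\<forall>c x. 0 \<le> c \<longrightarrow> p (c *\<^sub>R x) = c * p x)"

lemma sublinear_add: "sublinear p \<Longrightarrow> p (x + y) \<le> p x + p y"
  by (simp add: sublinear_def)

lemma sublinear_scale: "sublinear p \<Longrightarrow> 0 \<le> c \<Longrightarrow> p (c *\<^sub>R x) = c * p x"
  by (simp add: sublinear_def)

lemma sublinear_zero: "sublinear p \<Longrightarrow> p 0 = 0"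
  using sublinear_scale[of p 0 0] by simp

lemma sublinear_ge_uminus: "sublinear p \<Longrightarrow> - p (- x) \<le> p x"
  using sublinear_add[of p x "- x"] sublinear_zero[of p] by simp

lemma sublinear_norm: "sublinear norm"
  by (simp add: sublinear_def norm_triangle_ineq)

text \<open>
  The opposite inequality for homogeneity follows by applying the assumed one to \<open>1 / c\<close>, and the
  one at \<open>0\<close> follows from subadditivity.
\<close>
lemma sublinearI:
  assumes add: "\<And>x y. p (x + y) \<le> p x + p y"
    and scale: "\<And>c x. 0 < c \<Longrightarrow> p (c *\<^sub>R x) \<le> c * p x"
    and zero: "p 0 \<le> 0"
  shows "sublinear p"
proof -
  have "p 0 = 0"
    using add[of 0 0] zero by simp
  moreover have "p (c *\<^sub>R x) = c * p x" if "0 < c" for c x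
  proof (rule antisym)
    have "p x \<le> (1 / c) * p (c *\<^sub>R x)"
      using scale[of "1 / c" "c *\<^sub>R x"] that by simp
    then show "c * p x \<le> p (c *\<^sub>R x)"
      using that by (simp add: field_simps)
  qed (use scale that in blast)
  ultimately have "p (c *\<^sub>R x) = c * p x" if "0 \<le> c" for c x
    using that by (cases "c = 0") auto
  then show ?thesis
    using add by (simp add: sublinear_def)
qed

text \<open>
  The hypotheses cover both a chain of sublinear functionals and the family defining \<open>tilt\<close>
  below, whose individual members need not be sublinear.
\<close>
lemma sublinear_INF:
  fixes g :: "'i \<Rightarrow> 'a::real_vector \<Rightarrow> real"
  assumes bdd: "\<And>x. bdd_below ((\<lambda>i. g i x) ` I)"
    and add: "\<And>i j x y. i \<in> I \<Longrightarrow> j \<in> I \<Longrightarrow> \<exists>k\<in>I. g k (x + y) \<le> g i x + g j y"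
    and scale: "\<And>i c x. i \<in> I \<Longrightarrow> 0 < c \<Longrightarrow> \<exists>k\<in>I. g k (c *\<^sub>R x) \<le> c * g i x"
    and zero: "\<exists>i\<in>I. g i 0 \<le> 0"
  shows "sublinear (\<lambda>x. INF i\<in>I. g i x)" (is "sublinear ?q")
proof (rule sublinearI)
  have ne: "I \<noteq> {}"
    using zero by blast
  have lower: "?q x \<le> g i x" if "i \<in> I" for i x
    using cINF_lower[OF bdd that] .
  show "?q (x + y) \<le> ?q x + ?q y" for x y
  proof -
    have "?q (x + y) \<le> g i x + g j y" if "i \<in> I" "j \<in> I" for i j
      using add[OF that] lower order_trans by blast
    then have "?q (x + y) - g j y \<le> ?q x" if "j \<in> I" for j
      by (intro cINF_greatest[OF ne]) (use that in \<open>simp add: algebra_simps\<close>)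
    then have "?q (x + y) - ?q x \<le> ?q y"
      by (intro cINF_greatest[OF ne]) (simp add: algebra_simps)
    then show ?thesis
      by simp
  qed
  show "?q (c *\<^sub>R x) \<le> c * ?q x" if "0 < c" for c x
  proof -
    have "?q (c *\<^sub>R x) \<le> c * g i x" if "i \<in> I" for i
      using scale[OF that \<open>0 < c\<close>] lower order_trans by blast
    then have "?q (c *\<^sub>R x) / c \<le> ?q x"
      by (intro cINF_greatest[OF ne]) (use that in \<open>simp add: field_simps\<close>)
    then show ?thesis
      using that by (simp add: field_simps)
  qed
  show "?q 0 \<le> 0"
    using zero lower order_trans by blast
qed

text \<open>
  The largest sublinear functional \<open>q \<le> p\<close> with \<open>q (- y) = - p y\<close>. It serves twice: a minimal
  \<open>p\<close> equals all its tilts and is therefore odd, and tilting the norm at \<open>x\<close> before minimising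
  forces the resulting linear functional to be norming at \<open>x\<close>.
\<close>
definition tilt :: "('a::real_vector \<Rightarrow> real) \<Rightarrow> 'a \<Rightarrow> 'a \<Rightarrow> real" where
  "tilt p y x = (INF t\<in>{0..}. p (x + t *\<^sub>R y) - t * p y)"

lemma tilt_lower:
  assumes "sublinear p" "0 \<le> t"
  shows "tilt p y x \<le> p (x + t *\<^sub>R y) - t * p y"
    and "bdd_below ((\<lambda>t. p (x + t *\<^sub>R y) - t * p y) ` {0..})"
proof -
  have "- p (- x) \<le> p (x + s *\<^sub>R y) - s * p y" if "0 \<le> s" for s
    using sublinear_add[OF assms(1), of "x + s *\<^sub>R y" "- x"] sublinear_scale[OF assms(1) that, of y]
    by simp
  then show bdd: "bdd_below ((\<lambda>t. p (x + t *\<^sub>R y) - t * p y) ` {0..})"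
    by (intro bdd_belowI2) simp
  show "tilt p y x \<le> p (x + t *\<^sub>R y) - t * p y"
    unfolding tilt_def using cINF_lower[OF bdd, of t] assms(2) by simp
qed

lemma tilt_le: "sublinear p \<Longrightarrow> tilt p y x \<le> p x"
  using tilt_lower(1)[of p 0 y x] by simp

lemma tilt_uminus_le: "sublinear p \<Longrightarrow> tilt p y (- y) \<le> - p y"
  using tilt_lower(1)[of p 1 y "- y"] sublinear_zero[of p] by simp

lemma sublinear_tilt:
  assumes p: "sublinear p"
  shows "sublinear (tilt p y)"
  unfolding tilt_def
proof (rule sublinear_INF)
  fix s t :: real and x z
  assume "s \<in> {0..}" "t \<in> {0..}"
  moreover have "x + z + (s + t) *\<^sub>R y = (x + s *\<^sub>R y) + (z + t *\<^sub>R y)"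
    by (simp add: algebra_simps)
  then have "p (x + z + (s + t) *\<^sub>R y) \<le> p (x + s *\<^sub>R y) + p (z + t *\<^sub>R y)"
    using sublinear_add[OF p] by metis
  ultimately show "\<exists>k\<in>{0..}. p (x + z + k *\<^sub>R y) - k * p y
      \<le> (p (x + s *\<^sub>R y) - s * p y) + (p (z + t *\<^sub>R y) - t * p y)"
    by (intro bexI[of _ "s + t"]) (auto simp: algebra_simps)
next
  fix t c :: real and x
  assume "t \<in> {0..}" "0 < c"
  moreover have "c *\<^sub>R x + (c * t) *\<^sub>R y = c *\<^sub>R (x + t *\<^sub>R y)"
    by (simp add: algebra_simps)
  then have "p (c *\<^sub>R x + (c * t) *\<^sub>R y) = c * p (x + t *\<^sub>R y)"
    using sublinear_scale[OF p] \<open>0 < c\<close> by (metis less_imp_le)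
  ultimately show "\<exists>k\<in>{0..}. p (c *\<^sub>R x + k *\<^sub>R y) - k * p y \<le> c * (p (x + t *\<^sub>R y) - t * p y)"
    by (intro bexI[of _ "c * t"]) (auto simp: algebra_simps)
next
  show "\<exists>t\<in>{0..}. p (0 + t *\<^sub>R y) - t * p y \<le> 0"
    using sublinear_zero[OF p] by (intro bexI[of _ 0]) auto
qed (use tilt_lower(2)[OF p order_refl] in auto)

lemma sublinear_odd_imp_linear:
  assumes p: "sublinear p" and odd: "\<And>x. p (- x) = - p x"
  shows "linear p"
proof (rule linearI)
  show "p (x + y) = p x + p y" for x y
    using sublinear_add[OF p, of x y] sublinear_add[OF p, of "x + y" "- y"] odd[of y] by simp
  show "p (c *\<^sub>R x) = c *\<^sub>R p x" for c x
  proof (cases "0 \<le> c")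
    case False
    then show ?thesis
      using sublinear_scale[OF p, of "- c" x] odd[of "c *\<^sub>R x"] by simp
  qed (simp add: sublinear_scale[OF p])
qed

text \<open>
  Hahn--Banach for sublinear functionals: Zorn's lemma gives a minimal sublinear functional below
  \<open>p\<close>, chains being bounded by their pointwise infimum. By minimality it equals each of its tilts,
  hence is odd, hence linear.
\<close>
lemma linear_below_sublinear:
  fixes p :: "'a::real_vector \<Rightarrow> real"
  assumes p: "sublinear p"
  obtains f where "linear f" "\<And>x. f x \<le> p x"
proof -
  define A where "A = {q. sublinear q \<and> q \<le> p}"
  have "\<exists>m\<in>A. \<forall>a\<in>A. a \<le> m \<longrightarrow> a = m"
  proof (rule predicate_Zorn[where P = "\<lambda>a b. b \<le> a"])
    show "partial_order_on A (relation_of (\<lambda>a b. b \<le> a) A)"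
      by (rule partial_order_on_relation_ofI) auto
  next
    fix C
    assume C: "C \<in> Chains (relation_of (\<lambda>a b. b \<le> a) A)"
    then have CA: "q \<in> A" if "q \<in> C" for q
      using that by (auto simp: Chains_def relation_of_def)
    have total: "q \<le> r \<or> r \<le> q" if "q \<in> C" "r \<in> C" for q r
      using C that by (auto simp: Chains_def relation_of_def)
    show "\<exists>u\<in>A. \<forall>a\<in>C. u \<le> a"
    proof (cases "C = {}")
      case True
      then show ?thesis
        using p by (auto simp: A_def)
    next
      case False
      have bdd: "bdd_below ((\<lambda>q. q x) ` C)" for x
      proof (rule bdd_belowI2)
        show "- p (- x) \<le> q x" if "q \<in> C" for q
          using sublinear_ge_uminus[of q x] CA[OF that] le_funD[of q p "- x"] by (auto simp: A_def)
      qed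
      define u where "u = (\<lambda>x. INF q\<in>C. q x)"
      have "sublinear u"
        unfolding u_def
      proof (rule sublinear_INF[OF bdd])
        fix q r x y
        assume qr: "q \<in> C" "r \<in> C"
        \<comment> \<open>the smaller of the two functionals serves both summands\<close>
        from total[OF qr] show "\<exists>k\<in>C. k (x + y) \<le> q x + r y"
        proof
          assume "q \<le> r"
          then show ?thesis
            using sublinear_add[of q x y] CA[OF qr(1)] le_funD[of q r y] qr
            by (intro bexI[of _ q]) (auto simp: A_def)
        next
          assume "r \<le> q"
          then show ?thesis
            using sublinear_add[of r x y] CA[OF qr(2)] le_funD[of r q x] qr
            by (intro bexI[of _ r]) (auto simp: A_def)
        qed
      next
        show "\<exists>k\<in>C. k (c *\<^sub>R x) \<le> c * q x" if "q \<in> C" "0 < c" for q c x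
          using that CA[OF that(1)] sublinear_scale[of q c x] by (intro bexI[of _ q]) (auto simp: A_def)
      next
        show "\<exists>q\<in>C. q 0 \<le> 0"
          using False CA sublinear_zero by (fastforce simp: A_def)
      qed
      moreover have le: "u \<le> q" if "q \<in> C" for q
        unfolding u_def le_fun_def using cINF_lower[OF bdd that] by blast
      moreover have "u \<le> p"
        using False le CA by (auto simp: A_def intro: order_trans)
      ultimately show ?thesis
        by (auto simp: A_def)
    qed
  qed
  then obtain m where m: "sublinear m" "m \<le> p"
    and minimal: "\<And>q. sublinear q \<Longrightarrow> q \<le> m \<Longrightarrow> q = m"
    unfolding A_def by (auto intro: order_trans)
  have "m (- x) = - m x" for x
  proof -
    have "tilt m x = m"
      using minimal[OF sublinear_tilt[OF m(1)]] tilt_le[OF m(1)] by (simp add: le_fun_def)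
    then show ?thesis
      using tilt_uminus_le[OF m(1), of x] sublinear_ge_uminus[OF m(1), of "- x"] by simp
  qed
  then show ?thesis
    using that sublinear_odd_imp_linear[OF m(1)] m(2) by (auto simp: le_fun_def)
qed

lemma norming_functional:
  fixes x :: "'a::real_normed_vector"
  obtains f :: "'a dual" where "norm f \<le> 1" "blinfun_apply f x = norm x"
proof -
  obtain f where lin: "linear f" and le: "\<And>z. f z \<le> tilt norm x z"
    using linear_below_sublinear[OF sublinear_tilt[OF sublinear_norm]] by blast
  have "f z \<le> norm z" for z
    using le[of z] tilt_le[OF sublinear_norm, of x z] by linarith
  from this this[of "- _"] have bound: "\<bar>f z\<bar> \<le> norm z" for z
    by (metis abs_le_iff lin linear_neg norm_minus_cancel)
  then have bl: "bounded_linear f"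
    using lin by (intro bounded_linear_intro[where K = 1]) (auto simp: linear_iff)
  have "f (- x) \<le> - norm x"
    using le[of "- x"] tilt_uminus_le[OF sublinear_norm, of x] by linarith
  then have "f x = norm x"
    using linear_neg[OF lin, of x] bound[of x] by linarith
  with bl bound show ?thesis
    by (intro that[of "Blinfun f"] norm_blinfun_bound) (auto simp: bounded_linear_Blinfun_apply)
qed

lemma eq_if_functionals_eq:
  fixes u v :: "'a::real_normed_vector"
  assumes "\<And>f :: 'a dual. blinfun_apply f u = blinfun_apply f v"
  shows "u = v"
proof -
  obtain f :: "'a dual" where "blinfun_apply f (u - v) = norm (u - v)"
    using norming_functional[of "u - v"] by blast
  then show ?thesis
    using assms[of f] by (simp add: blinfun.diff_right)
qed

lemma norm_blinfun_boundI:
  assumes "\<And>x. norm x \<le> 1 \<Longrightarrow> norm (blinfun_apply T x) \<le> b"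
  shows "norm T \<le> b"
proof (rule norm_blinfun_bound)
  show "0 \<le> b"
    using assms[of 0] by simp
  show "norm (blinfun_apply T x) \<le> b * norm x" for x
  proof (cases "x = 0")
    case False
    then have "norm (blinfun_apply T x) / norm x \<le> b"
      using assms[of "x /\<^sub>R norm x"] by (simp add: blinfun.scaleR_right field_simps)
    then show ?thesis
      using False by (simp add: field_simps)
  qed simp
qed

lemma norm_blinfun_le:
  assumes "norm x \<le> 1"
  shows "norm (blinfun_apply T x) \<le> norm T"
  using norm_blinfun[of T x] mult_left_mono[OF assms norm_ge_zero[of T]] by simp


section \<open>The adjoint\<close>

definition adjoint_blinfun ::
    "('a::real_normed_vector \<Rightarrow>\<^sub>L 'b::real_normed_vector) \<Rightarrow> 'b dual \<Rightarrow>\<^sub>L 'a dual" where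
  "adjoint_blinfun T = Blinfun (\<lambda>f. f o\<^sub>L T)"

lemma adjoint_blinfun_apply [simp]:
  "blinfun_apply (blinfun_apply (adjoint_blinfun T) f) x = blinfun_apply f (blinfun_apply T x)"
  unfolding adjoint_blinfun_def
  by (simp add: bounded_linear_Blinfun_apply
      bounded_bilinear.bounded_linear_left[OF bounded_bilinear_blinfun_compose])

lemma adjoint_blinfun_add: "adjoint_blinfun (S + T) = adjoint_blinfun S + adjoint_blinfun T"
  by (intro blinfun_eqI) (simp add: blinfun.add_left blinfun.add_right)

lemma norm_adjoint_blinfun:
  fixes T :: "'a::real_normed_vector \<Rightarrow>\<^sub>L 'b::real_normed_vector"
  shows "norm (adjoint_blinfun T) = norm T"
proof (rule antisym)
  show "norm (adjoint_blinfun T) \<le> norm T"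
  proof (intro norm_blinfun_boundI)
    fix f :: "'b dual" and x :: 'a
    assume "norm f \<le> 1" "norm x \<le> 1"
    then have "norm f * norm (blinfun_apply T x) \<le> 1 * norm T"
      by (intro mult_mono norm_blinfun_le) auto
    then show "norm (blinfun_apply (blinfun_apply (adjoint_blinfun T) f) x) \<le> norm T"
      using norm_blinfun[of f "blinfun_apply T x"] by simp
  qed
  show "norm T \<le> norm (adjoint_blinfun T)"
  proof (rule norm_blinfun_boundI)
    fix x :: 'a
    assume x: "norm x \<le> 1"
    obtain f :: "'b dual" where f: "norm f \<le> 1" "blinfun_apply f (blinfun_apply T x) = norm (blinfun_apply T x)"
      using norming_functional by blast
    have "norm (blinfun_apply T x) = norm (blinfun_apply (blinfun_apply (adjoint_blinfun T) f) x)"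
      using f(2) by simp
    also have "\<dots> \<le> norm (blinfun_apply (adjoint_blinfun T) f)"
      by (rule norm_blinfun_le[OF x])
    also have "\<dots> \<le> norm (adjoint_blinfun T)"
      by (rule norm_blinfun_le[OF f(1)])
    finally show "norm (blinfun_apply T x) \<le> norm (adjoint_blinfun T)" .
  qed
qed

text \<open>
  For fixed \<open>x\<close>, the map \<open>f \<mapsto> R f x\<close> is an element of \<open>F\<^sup>*\<^sup>*\<close>, so by reflexivity it is evaluation
  at some point \<open>T x\<close> of \<open>F\<close>. That \<open>T\<close> is linear and bounded can be tested by functionals.
\<close>
lemma adjoint_surj:
  fixes R :: "'b::banach dual \<Rightarrow>\<^sub>L 'a::real_normed_vector dual"
  assumes "reflexive_space TYPE('b)"
  obtains T :: "'a \<Rightarrow>\<^sub>L 'b" where "R = adjoint_blinfun T"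
proof -
  have "\<exists>y. \<forall>f :: 'b dual. blinfun_apply f y = blinfun_apply (blinfun_apply R f) x" for x
  proof -
    obtain y where "canonical_embedding x o\<^sub>L R = canonical_embedding (y :: 'b)"
      using assms unfolding reflexive_space_def by (metis surjD)
    then have "blinfun_apply (canonical_embedding y) f = blinfun_apply (canonical_embedding x o\<^sub>L R) f" for f
      by simp
    then show ?thesis
      by auto
  qed
  then obtain t where t: "\<And>x (f :: 'b dual). blinfun_apply f (t x) = blinfun_apply (blinfun_apply R f) x"
    by metis
  have bl: "bounded_linear t"
  proof (rule bounded_linear_intro)
    show "t (x + y) = t x + t y" for x y
      by (rule eq_if_functionals_eq) (simp add: t blinfun.add_right)
    show "t (c *\<^sub>R x) = c *\<^sub>R t x" for c x
      by (rule eq_if_functionals_eq) (simp add: t blinfun.scaleR_right)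
    show "norm (t x) \<le> norm x * norm R" for x
    proof -
      obtain f :: "'b dual" where f: "norm f \<le> 1" "blinfun_apply f (t x) = norm (t x)"
        using norming_functional by blast
      have "norm (t x) = blinfun_apply (blinfun_apply R f) x"
        using f(2) t[of f x] by simp
      also have "\<dots> \<le> norm (blinfun_apply R f) * norm x"
        using norm_blinfun[of "blinfun_apply R f" x] by simp
      also have "\<dots> \<le> norm R * norm x"
        by (intro mult_right_mono norm_blinfun_le f(1)) simp
      finally show ?thesis
        by (simp add: mult.commute)
    qed
  qed
  have "R = adjoint_blinfun (Blinfun t)"
    by (intro blinfun_eqI) (simp add: bounded_linear_Blinfun_apply[OF bl] t)
  then show ?thesis
    by (rule that)
qed


section \<open>Schauder's theorem\<close>

text \<open>
  Total boundedness is symmetric in the two arguments of a bounded kernel. Up to \<open>e / 4\<close>, a column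
  is determined by its entries in the finitely many rows of a net, and rounding these entries down
  to multiples of \<open>e / 4\<close> leaves finitely many possibilities; one column for each of them gives a net.
\<close>
lemma totally_bounded_kernel_swap:
  fixes b :: "'a \<Rightarrow> 'b \<Rightarrow> real"
  assumes bound: "\<And>x y. x \<in> A \<Longrightarrow> y \<in> B \<Longrightarrow> \<bar>b x y\<bar> \<le> M"
    and rows: "\<And>e. 0 < e \<Longrightarrow> \<exists>N. finite N \<and> N \<subseteq> A \<and> (\<forall>x\<in>A. \<exists>a\<in>N. \<forall>y\<in>B. \<bar>b x y - b a y\<bar> < e)"
    and e: "0 < e"
  shows "\<exists>N. finite N \<and> N \<subseteq> B \<and> (\<forall>y\<in>B. \<exists>c\<in>N. \<forall>x\<in>A. \<bar>b x y - b x c\<bar> < e)"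
proof -
  define d where "d = e / 4"
  have d: "0 < d"
    using e by (simp add: d_def)
  obtain N where N: "finite N" "N \<subseteq> A" and net: "\<And>x. x \<in> A \<Longrightarrow> \<exists>a\<in>N. \<forall>y\<in>B. \<bar>b x y - b a y\<bar> < d"
    using rows[OF d] by blast
  define code where "code = (\<lambda>y. restrict (\<lambda>a. \<lfloor>b a y / d\<rfloor>) N)"
  have "code ` B \<subseteq> N \<rightarrow>\<^sub>E {\<lfloor>- M / d\<rfloor>..\<lfloor>M / d\<rfloor>}"
  proof (intro image_subsetI PiE_I)
    fix y a
    assume "y \<in> B" "a \<in> N"
    then have "- M \<le> b a y" "b a y \<le> M"
      using bound[of a y] N(2) by auto
    then have "- M / d \<le> b a y / d" "b a y / d \<le> M / d"
      using d by (simp_all only: divide_right_mono less_imp_le)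
    then show "code y a \<in> {\<lfloor>- M / d\<rfloor>..\<lfloor>M / d\<rfloor>}"
      using \<open>a \<in> N\<close> unfolding code_def restrict_def by (auto intro: floor_mono)
  qed (auto simp: code_def)
  then have "finite (code ` B)"
    using finite_PiE[OF N(1)] finite_subset by (metis finite_atLeastAtMost_int)
  then obtain N' where N': "N' \<subseteq> B" "finite N'" "code ` B = code ` N'"
    using finite_subset_image[of "code ` B" code B] by blast
  have "\<exists>c\<in>N'. \<forall>x\<in>A. \<bar>b x y - b x c\<bar> < e" if y: "y \<in> B" for y
  proof -
    obtain c where c: "c \<in> N'" "code y = code c"
      using N'(3) y by blast
    have near: "\<bar>b a y - b a c\<bar> < d" if "a \<in> N" for a
    proof -
      have "\<lfloor>b a y / d\<rfloor> = \<lfloor>b a c / d\<rfloor>"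
        using fun_cong[OF c(2), of a] that by (simp add: code_def)
      then have "\<bar>b a y / d - b a c / d\<bar> < 1"
        by linarith
      also have "\<bar>b a y / d - b a c / d\<bar> = \<bar>b a y - b a c\<bar> / d"
        using d by (simp add: diff_divide_distrib[symmetric])
      finally show ?thesis
        using d by simp
    qed
    have "\<bar>b x y - b x c\<bar> < e" if x: "x \<in> A" for x
    proof -
      obtain a where a: "a \<in> N" "\<forall>y\<in>B. \<bar>b x y - b a y\<bar> < d"
        using net[OF x] by blast
      have "c \<in> B"
        using c(1) N'(1) by blast
      then have "\<bar>b x y - b a y\<bar> < d" "\<bar>b x c - b a c\<bar> < d" "\<bar>b a y - b a c\<bar> < d"
        using a near y by blast+
      then show ?thesis
        using e unfolding d_def by linarith
    qed
    then show ?thesis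
      using c(1) by blast
  qed
  then show ?thesis
    using N' by blast
qed

text \<open>Completeness of the target turns total boundedness of the image into relative compactness.\<close>
lemma compact_operator_iff_totally_bounded:
  fixes K :: "'a::real_normed_vector \<Rightarrow>\<^sub>L 'b::banach"
  shows "compact_operator K \<longleftrightarrow> (\<forall>e>0. \<exists>N. finite N \<and> N \<subseteq> cball 0 1 \<and>
           (\<forall>x\<in>cball 0 1. \<exists>a\<in>N. norm (blinfun_apply K x - blinfun_apply K a) < e))"
    (is "_ \<longleftrightarrow> ?tb")
proof
  assume "compact_operator K"
  then have cpt: "compact (closure (blinfun_apply K ` cball 0 1))"
    by (simp add: compact_operator_def)
  show ?tb
  proof (intro allI impI)
    fix e :: real
    assume "0 < e"
    then have "closure (blinfun_apply K ` cball 0 1) \<subseteq> (\<Union>a\<in>cball 0 1. ball (blinfun_apply K a) e)"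
      by (force simp: closure_approachable)
    then obtain N where N: "N \<subseteq> cball 0 1" "finite N"
      "closure (blinfun_apply K ` cball 0 1) \<subseteq> (\<Union>a\<in>N. ball (blinfun_apply K a) e)"
      using compactE_image[OF cpt, of "cball 0 1" "\<lambda>a. ball (blinfun_apply K a) e"] by auto
    have "\<exists>a\<in>N. norm (blinfun_apply K x - blinfun_apply K a) < e" if "x \<in> cball 0 1" for x
    proof -
      have "blinfun_apply K x \<in> closure (blinfun_apply K ` cball 0 1)"
        using that by (intro subsetD[OF closure_subset] imageI)
      then obtain a where "a \<in> N" "blinfun_apply K x \<in> ball (blinfun_apply K a) e"
        using N(3) by blast
      then show ?thesis
        by (auto simp: dist_norm norm_minus_commute)
    qed
    then show "\<exists>N. finite N \<and> N \<subseteq> cball 0 1 \<and>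
        (\<forall>x\<in>cball 0 1. \<exists>a\<in>N. norm (blinfun_apply K x - blinfun_apply K a) < e)"
      using N(1,2) by blast
  qed
next
  assume tb: ?tb
  show "compact_operator K"
    unfolding compact_operator_def compact_eq_totally_bounded
  proof (intro conjI allI impI)
    show "complete (closure (blinfun_apply K ` cball 0 1))"
      by (simp add: complete_eq_closed)
    fix e :: real
    assume "0 < e"
    then have "0 < e / 2"
      by simp
    then obtain N where N: "finite N"
      "\<And>x. x \<in> cball 0 1 \<Longrightarrow> \<exists>a\<in>N. norm (blinfun_apply K x - blinfun_apply K a) < e / 2"
      using tb by meson
    have "closure (blinfun_apply K ` cball 0 1) \<subseteq> (\<Union>y\<in>blinfun_apply K ` N. ball y e)"
    proof
      fix y
      assume "y \<in> closure (blinfun_apply K ` cball 0 1)"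
      then obtain x where x: "x \<in> cball 0 1" "dist (blinfun_apply K x) y < e / 2"
        using \<open>0 < e / 2\<close> unfolding closure_approachable by blast
      obtain a where a: "a \<in> N" "norm (blinfun_apply K x - blinfun_apply K a) < e / 2"
        using N(2)[OF x(1)] by blast
      have "dist (blinfun_apply K a) y < e"
        using x(2) a(2) dist_triangle_half_r[of "blinfun_apply K x" "blinfun_apply K a" e y]
        by (simp add: dist_norm)
      then show "y \<in> (\<Union>y\<in>blinfun_apply K ` N. ball y e)"
        using a(1) by auto
    qed
    then show "\<exists>k. finite k \<and> closure (blinfun_apply K ` cball 0 1) \<subseteq> (\<Union>y\<in>k. ball y e)"
      using N(1) by blast
  qed
qed

lemma norm_less_imp_functionals_less:
  assumes "norm v < e"
  shows "\<forall>f\<in>cball 0 1. \<bar>blinfun_apply (f :: 'a::real_normed_vector dual) v\<bar> < e"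
proof
  fix f :: "'a dual"
  assume "f \<in> cball 0 1"
  then have "norm f * norm v \<le> 1 * norm v"
    by (intro mult_right_mono) auto
  then show "\<bar>blinfun_apply f v\<bar> < e"
    using norm_blinfun[of f v] assms by simp
qed

text \<open>
  Both \<open>K\<close> and \<open>K\<^sup>*\<close> are governed by the kernel \<open>f (K x)\<close> on the product of the unit balls of \<open>E\<close> and
  \<open>F\<^sup>*\<close>: distances in \<open>K\<close>'s image are uniform distances between its rows, those in \<open>K\<^sup>*\<close>'s image are
  uniform distances between its columns.
\<close>
theorem compact_operator_adjoint_iff:
  fixes K :: "'a::real_normed_vector \<Rightarrow>\<^sub>L 'b::banach"
  shows "compact_operator (adjoint_blinfun K) \<longleftrightarrow> compact_operator K"
proof
  let ?B = "cball 0 1 :: 'a set" and ?B' = "cball 0 1 :: 'b dual set"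
  let ?b = "\<lambda>x f. blinfun_apply f (blinfun_apply K x)"
  have bound: "\<bar>?b x f\<bar> \<le> norm K" if "x \<in> ?B" "f \<in> ?B'" for x f
  proof -
    have "norm f * norm (blinfun_apply K x) \<le> 1 * norm K"
      using that by (intro mult_mono norm_blinfun_le) auto
    then show ?thesis
      using norm_blinfun[of f "blinfun_apply K x"] by simp
  qed
  {
    assume K: "compact_operator K"
    have rows: "\<exists>N. finite N \<and> N \<subseteq> ?B \<and> (\<forall>x\<in>?B. \<exists>a\<in>N. \<forall>f\<in>?B'. \<bar>?b x f - ?b a f\<bar> < e)"
      if e: "0 < e" for e
    proof -
      obtain N where "finite N" "N \<subseteq> ?B"
        "\<forall>x\<in>?B. \<exists>a\<in>N. norm (blinfun_apply K x - blinfun_apply K a) < e"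
        using K e unfolding compact_operator_iff_totally_bounded by meson
      moreover from this(3) have "\<forall>x\<in>?B. \<exists>a\<in>N. \<forall>f\<in>?B'. \<bar>?b x f - ?b a f\<bar> < e"
        using norm_less_imp_functionals_less[where 'a = 'b] unfolding blinfun.diff_right[symmetric]
        by meson
      ultimately show ?thesis
        by blast
    qed
    show "compact_operator (adjoint_blinfun K)"
      unfolding compact_operator_iff_totally_bounded
    proof (intro allI impI)
      fix e :: real
      assume "0 < e"
      then have "0 < e / 2"
        by simp
      from totally_bounded_kernel_swap[OF bound rows this]
      obtain N where N: "finite N" "N \<subseteq> ?B'"
        "\<forall>f\<in>?B'. \<exists>g\<in>N. \<forall>x\<in>?B. \<bar>?b x f - ?b x g\<bar> < e / 2"
        by blast
      have less: "norm (blinfun_apply (adjoint_blinfun K) f - blinfun_apply (adjoint_blinfun K) g) < e"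
        if "\<forall>x\<in>?B. \<bar>?b x f - ?b x g\<bar> < e / 2" for f g
      proof -
        have "norm (blinfun_apply (adjoint_blinfun K) f - blinfun_apply (adjoint_blinfun K) g) \<le> e / 2"
          by (rule norm_blinfun_boundI) (use that in \<open>auto simp: blinfun.diff_left intro: less_imp_le\<close>)
        then show ?thesis
          using \<open>0 < e\<close> by simp
      qed
      then show "\<exists>N. finite N \<and> N \<subseteq> ?B' \<and> (\<forall>f\<in>?B'. \<exists>g\<in>N.
          norm (blinfun_apply (adjoint_blinfun K) f - blinfun_apply (adjoint_blinfun K) g) < e)"
        using N by meson
    qed
  next
    assume K: "compact_operator (adjoint_blinfun K)"
    have columns: "\<exists>N. finite N \<and> N \<subseteq> ?B' \<and> (\<forall>f\<in>?B'. \<exists>g\<in>N. \<forall>x\<in>?B. \<bar>?b x f - ?b x g\<bar> < e)"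
      if e: "0 < e" for e
    proof -
      obtain N where "finite N" "N \<subseteq> ?B'" and N: "\<forall>f\<in>?B'. \<exists>g\<in>N.
          norm (blinfun_apply (adjoint_blinfun K) f - blinfun_apply (adjoint_blinfun K) g) < e"
        using K e unfolding compact_operator_iff_totally_bounded by meson
      have "\<bar>?b x f - ?b x g\<bar> < e" if "x \<in> ?B"
        "norm (blinfun_apply (adjoint_blinfun K) f - blinfun_apply (adjoint_blinfun K) g) < e" for x f g
        using norm_blinfun_le[of x "blinfun_apply (adjoint_blinfun K) f - blinfun_apply (adjoint_blinfun K) g"] that
        by (simp add: blinfun.diff_left)
      then have "\<forall>f\<in>?B'. \<exists>g\<in>N. \<forall>x\<in>?B. \<bar>?b x f - ?b x g\<bar> < e"
        using N by meson
      then show ?thesis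
        using \<open>finite N\<close> \<open>N \<subseteq> ?B'\<close> by blast
    qed
    show "compact_operator K"
      unfolding compact_operator_iff_totally_bounded
    proof (intro allI impI)
      fix e :: real
      assume "0 < e"
      have "\<exists>N. finite N \<and> N \<subseteq> ?B \<and> (\<forall>x\<in>?B. \<exists>a\<in>N. \<forall>f\<in>?B'. \<bar>?b x f - ?b a f\<bar> < e)"
        by (rule totally_bounded_kernel_swap[where b = "\<lambda>f x. ?b x f" and M = "norm K"])
          (use bound columns \<open>0 < e\<close> in auto)
      then obtain N where N: "finite N" "N \<subseteq> ?B"
        "\<forall>x\<in>?B. \<exists>a\<in>N. \<forall>f\<in>?B'. \<bar>?b x f - ?b a f\<bar> < e"
        by blast
      have "norm (blinfun_apply K x - blinfun_apply K a) < e"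
        if "\<forall>f\<in>?B'. \<bar>?b x f - ?b a f\<bar> < e" for x a
      proof -
        obtain f :: "'b dual" where f: "norm f \<le> 1" "blinfun_apply f (blinfun_apply K x - blinfun_apply K a)
            = norm (blinfun_apply K x - blinfun_apply K a)"
          using norming_functional by blast
        have "\<bar>?b x f - ?b a f\<bar> < e"
          using f(1) that by simp
        then show ?thesis
          using f(2) by (simp add: blinfun.diff_right)
      qed
      then show "\<exists>N. finite N \<and> N \<subseteq> ?B \<and>
          (\<forall>x\<in>?B. \<exists>a\<in>N. norm (blinfun_apply K x - blinfun_apply K a) < e)"
        using N by meson
    qed
  }
qed


section \<open>Norm attainment and duality\<close>

text \<open>
  For a nonzero operator a maximising point in the unit ball lies on the unit sphere. Nonzeroness
  excludes the trivial space, whose unit sphere is empty.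
\<close>
lemma attains_normI:
  assumes "T \<noteq> 0" "norm x \<le> 1" "norm T \<le> norm (blinfun_apply T x)"
  shows "attains_norm T"
proof -
  have "norm T * 1 \<le> norm T * norm x"
    using assms(3) norm_blinfun[of T x] by simp
  then have "norm x = 1"
    using assms(1,2) by (simp add: mult_le_cancel_left_pos)
  then show ?thesis
    unfolding attains_norm_def using assms(3) norm_blinfun_le[OF assms(2), of T]
    by (intro bexI[of _ x]) auto
qed

theorem attains_norm_adjoint_iff:
  fixes S :: "'a::banach \<Rightarrow>\<^sub>L 'b::real_normed_vector"
  assumes "reflexive_space TYPE('a)" and "S \<noteq> 0"
  shows "attains_norm (adjoint_blinfun S) \<longleftrightarrow> attains_norm S"
proof
  assume "attains_norm S"
  then obtain x where x: "norm x = 1" "norm (blinfun_apply S x) = norm S"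
    by (auto simp: attains_norm_def)
  obtain f :: "'b dual" where f: "norm f \<le> 1"
    "blinfun_apply f (blinfun_apply S x) = norm (blinfun_apply S x)"
    using norming_functional by blast
  have "norm S \<le> norm (blinfun_apply (adjoint_blinfun S) f)"
    using norm_blinfun_le[of x "blinfun_apply (adjoint_blinfun S) f"] x f(2) by simp
  moreover have "adjoint_blinfun S \<noteq> 0"
    using assms(2) norm_adjoint_blinfun[of S] by auto
  ultimately show "attains_norm (adjoint_blinfun S)"
    using f(1) by (intro attains_normI[of _ f]) (auto simp: norm_adjoint_blinfun)
next
  assume "attains_norm (adjoint_blinfun S)"
  then obtain f where f: "norm f = 1" "norm (blinfun_apply (adjoint_blinfun S) f) = norm S"
    by (auto simp: attains_norm_def norm_adjoint_blinfun)
  obtain \<Phi> :: "'a dual dual" where \<Phi>: "norm \<Phi> \<le> 1"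
    "blinfun_apply \<Phi> (blinfun_apply (adjoint_blinfun S) f) = norm S"
    using norming_functional[of "blinfun_apply (adjoint_blinfun S) f"] f(2) by metis
  obtain x where x: "\<Phi> = canonical_embedding x"
    using assms(1) unfolding reflexive_space_def by (metis surjD)
  have "norm x \<le> 1"
  proof -
    obtain g :: "'a dual" where g: "norm g \<le> 1" "blinfun_apply g x = norm x"
      using norming_functional by blast
    then show ?thesis
      using norm_blinfun_le[OF g(1), of \<Phi>] \<Phi>(1) x by simp
  qed
  moreover have "norm S \<le> norm (blinfun_apply S x)"
    using norm_blinfun[of f "blinfun_apply S x"] \<Phi>(2) f(1) x by simp
  ultimately show "attains_norm S"
    using assms(2) by (intro attains_normI)
qed

theorem proposition2p3:
  assumes "reflexive_space TYPE('e::banach)"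
    and "reflexive_space TYPE('f::banach)"
  shows "compact_perturbation_property TYPE('e) TYPE('f) \<longleftrightarrow>
         compact_perturbation_property TYPE('f dual) TYPE('e dual)"
proof -
  let ?P = "\<lambda>R L. compact_operator L \<longrightarrow> norm (R + L) > norm R \<longrightarrow> attains_norm (R + L)"
  have transfer: "?P (adjoint_blinfun T) (adjoint_blinfun K) \<longleftrightarrow> ?P T K" for T K :: "'e \<Rightarrow>\<^sub>L 'f"
  proof -
    have "attains_norm (adjoint_blinfun (T + K)) \<longleftrightarrow> attains_norm (T + K)"
      if "norm (T + K) > norm T"
      using that norm_ge_zero[of T] by (intro attains_norm_adjoint_iff[OF assms(1)]) auto
    then show ?thesis
      by (auto simp: adjoint_blinfun_add[symmetric] norm_adjoint_blinfun compact_operator_adjoint_iff)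
  qed
  show ?thesis
    unfolding compact_perturbation_property_def
  proof (intro iffI allI)
    fix R L :: "'f dual \<Rightarrow>\<^sub>L 'e dual"
    assume *: "\<forall>(T :: 'e \<Rightarrow>\<^sub>L 'f) K. ?P T K"
    obtain T K :: "'e \<Rightarrow>\<^sub>L 'f" where "R = adjoint_blinfun T" "L = adjoint_blinfun K"
      using adjoint_surj[OF assms(2)] by metis
    with * show "?P R L"
      using transfer by blast
  next
    fix T K :: "'e \<Rightarrow>\<^sub>L 'f"
    assume "\<forall>(R :: 'f dual \<Rightarrow>\<^sub>L 'e dual) L. ?P R L"
    then show "?P T K"
      using transfer by blast
  qed
qed

end
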